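(* Let $X$ be a QFS-space, let $b\in X$, and let $a\in X$ be a lower bound of $\Uparrow_d b=\{x\in X: b\ll_d x\}$. Then the subspace $\{a\}\cup\Uparrow_d b$ of $X$ is a continuous retract of $X$, and $\{a\}\cup\Uparrow_d b$ is a QFS-space.
   Context: All topological spaces are $T_0$. For a space $(X,\tau)$, order-theoretic notions refer to the specialization order: $x\le y$ iff $x\in \mathrm{cl}_\tau\{y\}$. For $A\subseteq X$, $\uparrow A=\{x:\exists a\in A,\ a\le x\}$. A directed subset $D$ of $X$ (nonempty, every two elements have an upper bound in $D$), viewed as a net indexed by itself, converges to $x$, written $D\to_\tau x$, if it is eventually in every open neighbourhood of $x$. A set $U\subseteq X$ is directed open if for every directed $D$ and every $x\in U$ with $D\to_\tau x$ one has $D\cap U\neq\emptyset$; $d(X)$ is the family of directed open sets. $X$ is a directed space if $d(X)=\tau$. In a directed space $X$, $x\ll_d y$ means: for every directed $D\subseteq X$ with $D\to_\tau y$ there is $d\in D$ with $x\le d$. $Y$ is a continuous retract of $X$ if there are continuous functions $f:X\to Y$ and $g:Y\to X$ with $f\circ g=1_Y$. $\mathcal{P}^w(X)$ is the set of nonempty finite subsets of $X$. A nonempty family $\mathcal{F}\subseteq\mathcal{P}^w(X)$ is directed if for all $F_1,F_2\in\mathcal{F}$ there is $F\in\mathcal{F}$ with $F\subseteq\uparrow F_1\cap\uparrow F_2$; a directed family $\mathcal{F}$ converges to $x$, written $\mathcal{F}\to_\tau x$, if every open neighbourhood $U$ of $x$ contains some $F\in\mathcal{F}$ as a subset. For a directed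 space $X$, a map $\delta:X\to\mathcal{P}^w(X)$ is quasi-finitely separating if: (i) $a\le b$ implies $\delta(b)\subseteq\uparrow\delta(a)$; (ii) there is a finite set $F_\delta\subseteq X$ such that for every $x\in X$ there is $y\in F_\delta$ with $x\in\uparrow y\subseteq\uparrow\delta(x)$; (iii) for every directed $D\subseteq X$ with $D\to_\tau x$ and every open $U$ with $\delta(x)\subseteq U$, there is $d\in D$ with $\delta(d)\subseteq U$. A set $\mathcal{D}$ of maps $X\to\mathcal{P}^w(X)$ is directed if it is nonempty and for all $\delta_1,\delta_2\in\mathcal{D}$ there is $\delta\in\mathcal{D}$ with $\delta(x)\subseteq\uparrow\delta_1(x)\cap\uparrow\delta_2(x)$ for all $x\in X$. A quasi-approximate identity for $X$ is a directed set $\mathcal{D}$ of maps $X\to\mathcal{P}^w(X)$ such that for every $x\in X$, $\{\delta(x):\delta\in\mathcal{D}\}\to_\tau x$. A QFS-space is a directed space that has a quasi-approximate identity consisting of quasi-finitely separating maps. *)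

theory Defs
  imports "HOL-Analysis.Analysis"
begin

text \<open>
  A space is a value of type \<^typ>\<open>'a topology\<close> with carrier \<^const>\<open>topspace\<close>; all order-theoretic
  notions refer to its specialization order.
\<close>

definition spec_le :: "'a topology \<Rightarrow> 'a \<Rightarrow> 'a \<Rightarrow> bool" where
  "spec_le X x y \<longleftrightarrow> x \<in> topspace X \<and> y \<in> topspace X \<and> x \<in> X closure_of {y}"

definition up_set :: "'a topology \<Rightarrow> 'a set \<Rightarrow> 'a set" where
  "up_set X A = {x \<in> topspace X. \<exists>a\<in>A. spec_le X a x}"

definition directed_subset :: "'a topology \<Rightarrow> 'a set \<Rightarrow> bool" where
  "directed_subset X D \<longleftrightarrow>
     D \<subseteq> topspace X \<and> D \<noteq> {} \<and> (\<forall>x\<in>D. \<forall>y\<in>D. \<exists>z\<in>D. spec_le X x z \<and> spec_le X y z)"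

text \<open>Convergence of a directed subset viewed as a net indexed by itself.\<close>

definition net_converges :: "'a topology \<Rightarrow> 'a set \<Rightarrow> 'a \<Rightarrow> bool" where
  "net_converges X D x \<longleftrightarrow>
     x \<in> topspace X \<and>
     (\<forall>U. openin X U \<and> x \<in> U \<longrightarrow> (\<exists>d\<^sub>0\<in>D. \<forall>d\<in>D. spec_le X d\<^sub>0 d \<longrightarrow> d \<in> U))"

definition directed_open :: "'a topology \<Rightarrow> 'a set \<Rightarrow> bool" where
  "directed_open X U \<longleftrightarrow>
     U \<subseteq> topspace X \<and>
     (\<forall>D x. directed_subset X D \<and> x \<in> U \<and> net_converges X D x \<longrightarrow> D \<inter> U \<noteq> {})"

definition directed_space :: "'a topology \<Rightarrow> bool" where
  "directed_space X \<longleftrightarrow> t0_space X \<and> Collect (directed_open X) = Collect (openin X)"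

definition way_below :: "'a topology \<Rightarrow> 'a \<Rightarrow> 'a \<Rightarrow> bool" where
  "way_below X x y \<longleftrightarrow>
     x \<in> topspace X \<and> y \<in> topspace X \<and>
     (\<forall>D. directed_subset X D \<and> net_converges X D y \<longrightarrow> (\<exists>d\<in>D. spec_le X x d))"

definition way_above :: "'a topology \<Rightarrow> 'a \<Rightarrow> 'a set" where
  "way_above X b = {x \<in> topspace X. way_below X b x}"

definition lower_bound :: "'a topology \<Rightarrow> 'a \<Rightarrow> 'a set \<Rightarrow> bool" where
  "lower_bound X a A \<longleftrightarrow> a \<in> topspace X \<and> (\<forall>x\<in>A. spec_le X a x)"

text \<open>\<^const>\<open>retraction_maps\<close> says that \<open>f\<close> and \<open>g\<close> are continuous and \<open>f \<circ> g\<close> is the identity on \<open>Y\<close>.\<close>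

definition continuous_retract :: "'b topology \<Rightarrow> 'a topology \<Rightarrow> bool" where
  "continuous_retract Y X \<longleftrightarrow> (\<exists>f g. retraction_maps X Y f g)"

definition fin_subsets :: "'a topology \<Rightarrow> 'a set set" where
  "fin_subsets X = {F. F \<subseteq> topspace X \<and> finite F \<and> F \<noteq> {}}"

definition directed_family :: "'a topology \<Rightarrow> 'a set set \<Rightarrow> bool" where
  "directed_family X \<F> \<longleftrightarrow>
     \<F> \<subseteq> fin_subsets X \<and> \<F> \<noteq> {} \<and>
     (\<forall>F\<^sub>1\<in>\<F>. \<forall>F\<^sub>2\<in>\<F>. \<exists>F\<in>\<F>. F \<subseteq> up_set X F\<^sub>1 \<inter> up_set X F\<^sub>2)"

definition family_converges :: "'a topology \<Rightarrow> 'a set set \<Rightarrow> 'a \<Rightarrow> bool" where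
  "family_converges X \<F> x \<longleftrightarrow>
     directed_family X \<F> \<and> x \<in> topspace X \<and>
     (\<forall>U. openin X U \<and> x \<in> U \<longrightarrow> (\<exists>F\<in>\<F>. F \<subseteq> U))"

text \<open>
  Maps from \<open>X\<close> to its nonempty finite subsets are total functions whose values outside
  \<^term>\<open>topspace X\<close> are irrelevant.
\<close>

definition quasi_finitely_separating :: "'a topology \<Rightarrow> ('a \<Rightarrow> 'a set) \<Rightarrow> bool" where
  "quasi_finitely_separating X \<delta> \<longleftrightarrow>
     \<delta> \<in> topspace X \<rightarrow> fin_subsets X \<and>
     (\<forall>a b. spec_le X a b \<longrightarrow> \<delta> b \<subseteq> up_set X (\<delta> a)) \<and>
     (\<exists>F. finite F \<and> F \<subseteq> topspace X \<and>
        (\<forall>x\<in>topspace X. \<exists>y\<in>F. x \<in> up_set X {y} \<and> up_set X {y} \<subseteq> up_set X (\<delta> x))) \<and>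
     (\<forall>D x U. directed_subset X D \<and> net_converges X D x \<and> openin X U \<and> \<delta> x \<subseteq> U \<longrightarrow>
        (\<exists>d\<in>D. \<delta> d \<subseteq> U))"

definition directed_maps :: "'a topology \<Rightarrow> ('a \<Rightarrow> 'a set) set \<Rightarrow> bool" where
  "directed_maps X \<D> \<longleftrightarrow>
     \<D> \<subseteq> topspace X \<rightarrow> fin_subsets X \<and> \<D> \<noteq> {} \<and>
     (\<forall>\<delta>\<^sub>1\<in>\<D>. \<forall>\<delta>\<^sub>2\<in>\<D>. \<exists>\<delta>\<in>\<D>. \<forall>x\<in>topspace X.
        \<delta> x \<subseteq> up_set X (\<delta>\<^sub>1 x) \<inter> up_set X (\<delta>\<^sub>2 x))"

definition quasi_approximate_identity :: "'a topology \<Rightarrow> ('a \<Rightarrow> 'a set) set \<Rightarrow> bool" where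
  "quasi_approximate_identity X \<D> \<longleftrightarrow>
     directed_maps X \<D> \<and> (\<forall>x\<in>topspace X. family_converges X {\<delta> x |\<delta>. \<delta> \<in> \<D>} x)"

definition QFS_space :: "'a topology \<Rightarrow> bool" where
  "QFS_space X \<longleftrightarrow>
     directed_space X \<and>
     (\<exists>\<D>. quasi_approximate_identity X \<D> \<and> (\<forall>\<delta>\<in>\<D>. quasi_finitely_separating X \<delta>))"

end

theory Submission
  imports Defs
begin

text \<open>
  Write \<open>\<Up>b\<close> for \<^term>\<open>way_above X b\<close> and \<open>Y = {a} \<union> \<Up>b\<close>. The candidate retraction fixes the points of
  \<open>\<Up>b\<close> and sends all others to \<open>a\<close>. An open set that contains \<open>a\<close> contains all of \<open>\<Up>b\<close>, so its
  preimage is the whole space; an open set that misses \<open>a\<close> has its trace on \<open>\<Up>b\<close> as preimage. Hence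
  the map is continuous as soon as \<open>\<Up>b\<close> is open, and this is where the hypothesis on the space
  enters (\<open>openin_way_above\<close>). That the retract is again a QFS-space is a general fact
  (\<open>QFS_space_retract\<close>): a retraction \<open>r\<close> with section \<open>s\<close> turns each \<open>\<delta>\<close> into \<open>y \<mapsto> r ` \<delta> (s y)\<close>.

  Two facts give the openness of \<open>\<Up>b\<close>. A quasi-finitely separating map satisfies \<open>\<delta> z \<lless> z\<close>, in the
  sense that every directed set converging to \<open>z\<close> meets the upper set of \<open>\<delta> z\<close>
  (\<open>quasi_finitely_separating_meets\<close>). Conversely, if \<open>b \<lless> x\<close>, then every directed family of finite
  sets that converges to \<open>x\<close> has a member above \<open>b\<close> (\<open>way_below_family\<close>); this is a consequence of
  Rudin's lemma (\<open>Rudin_lemma\<close>). Applied to the family of the sets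
  \<open>\<Union>z\<in>\<delta> x. \<delta>' z\<close>, the second fact yields \<open>\<delta>\<close> and \<open>\<delta>'\<close> with \<open>\<delta>' z \<subseteq> \<up>b\<close> for all \<open>z \<in> \<delta> x\<close>, and the first fact,
  for \<open>\<delta>'\<close>, makes this \<open>\<delta> x \<subseteq> \<Up>b\<close>. The first fact, now for \<open>\<delta>\<close>, then shows that a directed set
  converging to \<open>x\<close> enters \<open>\<Up>b\<close>, so \<open>\<Up>b\<close> is directed open.
\<close>

section \<open>Specialization order and convergence\<close>

lemma spec_le_iff:
  "spec_le X x y \<longleftrightarrow>
     x \<in> topspace X \<and> y \<in> topspace X \<and> (\<forall>U. openin X U \<and> x \<in> U \<longrightarrow> y \<in> U)"
  unfolding spec_le_def in_closure_of by auto

lemma spec_le_refl: "x \<in> topspace X \<Longrightarrow> spec_le X x x"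
  by (auto simp: spec_le_iff)

lemma spec_le_trans: "spec_le X x y \<Longrightarrow> spec_le X y z \<Longrightarrow> spec_le X x z"
  by (auto simp: spec_le_iff)

lemma spec_le_openin: "spec_le X x y \<Longrightarrow> openin X U \<Longrightarrow> x \<in> U \<Longrightarrow> y \<in> U"
  by (auto simp: spec_le_iff)

lemma mem_up_set: "x \<in> up_set X A \<longleftrightarrow> (\<exists>a\<in>A. spec_le X a x)"
  by (auto simp: up_set_def spec_le_iff)

lemma up_set_subset_openin: "openin X U \<Longrightarrow> A \<subseteq> U \<Longrightarrow> up_set X A \<subseteq> U"
  by (meson mem_up_set spec_le_openin subset_iff)

lemma up_set_least: "A \<subseteq> up_set X B \<Longrightarrow> up_set X A \<subseteq> up_set X B"
  by (meson mem_up_set spec_le_trans subset_iff)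

text \<open>
  Upper sets are the saturated sets: if no point of \<open>A\<close> lies below \<open>y\<close>, the complement of the
  closure of \<open>y\<close> is an open set around \<open>A\<close> that avoids \<open>y\<close>.
\<close>

lemma up_set_eq_saturation:
  assumes "A \<subseteq> topspace X" "y \<in> topspace X"
    and "\<And>U. openin X U \<Longrightarrow> A \<subseteq> U \<Longrightarrow> y \<in> U"
  shows "y \<in> up_set X A"
proof (rule ccontr)
  assume "y \<notin> up_set X A"
  then have "A \<subseteq> topspace X - X closure_of {y}"
    using assms(1,2) by (auto simp: mem_up_set spec_le_def)
  then have "y \<in> topspace X - X closure_of {y}"
    by (rule assms(3)[OF openin_diff[OF openin_topspace closedin_closure_of]])
  then show False
    using assms(2) by (auto simp: in_closure_of)
qed

lemma spec_le_continuous_map: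
  "continuous_map X Y f \<Longrightarrow> spec_le X x y \<Longrightarrow> spec_le Y (f x) (f y)"
  by (force simp: spec_le_iff continuous_map_def Pi_iff)

text \<open>Open sets are upper sets, so a directed net is eventually in one as soon as it meets it.\<close>

lemma net_converges_iff:
  assumes "directed_subset X D"
  shows "net_converges X D x \<longleftrightarrow>
           x \<in> topspace X \<and> (\<forall>U. openin X U \<and> x \<in> U \<longrightarrow> D \<inter> U \<noteq> {})"
proof -
  have "(\<exists>d\<^sub>0\<in>D. \<forall>d\<in>D. spec_le X d\<^sub>0 d \<longrightarrow> d \<in> U) \<longleftrightarrow> D \<inter> U \<noteq> {}" if "openin X U" for U
    using assms that unfolding directed_subset_def
    by (metis (no_types, lifting) disjoint_iff spec_le_openin spec_le_refl subsetD)
  then show ?thesis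
    unfolding net_converges_def by blast
qed

lemma net_converges_lower:
  assumes "directed_subset X D" "net_converges X D y" "spec_le X x y"
  shows "net_converges X D x"
  using assms by (auto simp: net_converges_iff spec_le_iff)

lemma directed_subset_image:
  assumes "continuous_map X Y f" "directed_subset X D"
  shows "directed_subset Y (f ` D)"
proof -
  have "f ` D \<subseteq> topspace Y"
    using assms by (auto simp: directed_subset_def continuous_map_def)
  then show ?thesis
    using assms(2) spec_le_continuous_map[OF assms(1)] unfolding directed_subset_def by blast
qed

lemma net_converges_image:
  assumes f: "continuous_map X Y f" and D: "directed_subset X D" "net_converges X D x"
  shows "net_converges Y (f ` D) (f x)"
proof -
  have x: "x \<in> topspace X" and D0: "D \<subseteq> topspace X"
    using D by (auto simp: net_converges_def directed_subset_def)
  have "f ` D \<inter> U \<noteq> {}" if U: "openin Y U" "f x \<in> U" for U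
  proof -
    have "openin X {z \<in> topspace X. f z \<in> U}"
      using f U by (simp add: openin_continuous_map_preimage)
    then have "D \<inter> {z \<in> topspace X. f z \<in> U} \<noteq> {}"
      using D U x unfolding net_converges_iff[OF D(1)] by blast
    then show ?thesis by auto
  qed
  moreover have "f x \<in> topspace Y"
    using f x by (auto simp: continuous_map_def)
  ultimately show ?thesis
    unfolding net_converges_iff[OF directed_subset_image[OF f D(1)]] by blast
qed

lemma openin_imp_directed_open: "openin X U \<Longrightarrow> directed_open X U"
  by (auto simp: directed_open_def net_converges_iff openin_subset)

lemma directed_space_openin_iff: "directed_space X \<Longrightarrow> openin X U \<longleftrightarrow> directed_open X U"
  by (auto simp: directed_space_def)

lemma quasi_finitely_separatingD:
  assumes "quasi_finitely_separating X \<delta>"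
  shows "x \<in> topspace X \<Longrightarrow> \<delta> x \<in> fin_subsets X"
    and "spec_le X x y \<Longrightarrow> \<delta> y \<subseteq> up_set X (\<delta> x)"
    and "\<exists>F. finite F \<and> F \<subseteq> topspace X \<and>
           (\<forall>x\<in>topspace X. \<exists>y\<in>F. x \<in> up_set X {y} \<and> up_set X {y} \<subseteq> up_set X (\<delta> x))"
    and "directed_subset X D \<Longrightarrow> net_converges X D x \<Longrightarrow> openin X U \<Longrightarrow> \<delta> x \<subseteq> U \<Longrightarrow>
           \<exists>d\<in>D. \<delta> d \<subseteq> U"
proof -
  note * = assms[unfolded quasi_finitely_separating_def]
  show "x \<in> topspace X \<Longrightarrow> \<delta> x \<in> fin_subsets X"
    by (rule funcset_mem[OF *[THEN conjunct1]])
  show "spec_le X x y \<Longrightarrow> \<delta> y \<subseteq> up_set X (\<delta> x)"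
    using *[THEN conjunct2, THEN conjunct1] by simp
  show "\<exists>F. finite F \<and> F \<subseteq> topspace X \<and>
      (\<forall>x\<in>topspace X. \<exists>y\<in>F. x \<in> up_set X {y} \<and> up_set X {y} \<subseteq> up_set X (\<delta> x))"
    by (rule *[THEN conjunct2, THEN conjunct2, THEN conjunct1])
  show "\<exists>d\<in>D. \<delta> d \<subseteq> U"
    if "directed_subset X D" "net_converges X D x" "openin X U" "\<delta> x \<subseteq> U"
    using *[THEN conjunct2, THEN conjunct2, THEN conjunct2] that by simp
qed

lemma directed_mapsD:
  assumes "directed_maps X \<D>"
  shows "\<delta> \<in> \<D> \<Longrightarrow> x \<in> topspace X \<Longrightarrow> \<delta> x \<in> fin_subsets X"
    and "\<D> \<noteq> {}"
    and "\<delta>1 \<in> \<D> \<Longrightarrow> \<delta>2 \<in> \<D> \<Longrightarrow>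
           \<exists>\<delta>\<in>\<D>. \<forall>x\<in>topspace X. \<delta> x \<subseteq> up_set X (\<delta>1 x) \<inter> up_set X (\<delta>2 x)"
proof -
  note * = assms[unfolded directed_maps_def]
  show "\<delta> \<in> \<D> \<Longrightarrow> x \<in> topspace X \<Longrightarrow> \<delta> x \<in> fin_subsets X"
    by (rule funcset_mem[OF subsetD[OF *[THEN conjunct1]]])
  show "\<D> \<noteq> {}"
    by (rule *[THEN conjunct2, THEN conjunct1])
  show "\<exists>\<delta>\<in>\<D>. \<forall>x\<in>topspace X. \<delta> x \<subseteq> up_set X (\<delta>1 x) \<inter> up_set X (\<delta>2 x)"
    if "\<delta>1 \<in> \<D>" "\<delta>2 \<in> \<D>"
    by (rule *[THEN conjunct2, THEN conjunct2, rule_format, OF that])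
qed

lemma quasi_approximate_identityD:
  assumes "quasi_approximate_identity X \<D>"
  shows "directed_maps X \<D>"
    and "openin X U \<Longrightarrow> x \<in> U \<Longrightarrow> \<exists>\<delta>\<in>\<D>. \<delta> x \<subseteq> U"
proof -
  show "directed_maps X \<D>"
    using assms by (simp add: quasi_approximate_identity_def)
  assume U: "openin X U" "x \<in> U"
  then have "x \<in> topspace X"
    using openin_subset by blast
  then have "family_converges X {\<delta> x |\<delta>. \<delta> \<in> \<D>} x"
    using assms by (simp add: quasi_approximate_identity_def)
  then have "\<exists>F\<in>{\<delta> x |\<delta>. \<delta> \<in> \<D>}. F \<subseteq> U"
    using U by (simp add: family_converges_def)
  then show "\<exists>\<delta>\<in>\<D>. \<delta> x \<subseteq> U"
    by blast
qed

section \<open>Rudin's lemma\<close>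

text \<open>
  By Zorn's lemma the upper set can be enlarged to a maximal one, \<open>U\<close>, that includes no member of
  the family; members being finite, a union of a chain of such upper sets is again one. The required
  directed set is the complement of \<open>U\<close>. It is directed because, by maximality, adding the points
  above some \<open>x \<notin> U\<close> makes \<open>U\<close> include a member of the family, so that the part of this member
  outside \<open>U\<close> lies above \<open>x\<close>.
\<close>

lemma Rudin_lemma:
  assumes \<F>: "directed_family X \<F>"
    and K: "K \<subseteq> topspace X" "up_set X K \<subseteq> K" "\<And>F. F \<in> \<F> \<Longrightarrow> \<not> F \<subseteq> K"
  shows "\<exists>D. directed_subset X D \<and> D \<inter> K = {} \<and> (\<forall>F\<in>\<F>. D \<inter> F \<noteq> {})"
proof -
  define \<A> where
    "\<A> = {U. K \<subseteq> U \<and> U \<subseteq> topspace X \<and> up_set X U \<subseteq> U \<and> (\<forall>F\<in>\<F>. \<not> F \<subseteq> U)}"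
  have fin: "finite F" "F \<subseteq> topspace X" if "F \<in> \<F>" for F
    using \<F> that by (auto simp: directed_family_def fin_subsets_def)
  have "\<exists>M\<in>\<A>. \<forall>U\<in>\<A>. M \<subseteq> U \<longrightarrow> U = M"
  proof (rule subset_Zorn_nonempty)
    have "K \<in> \<A>"
      using K unfolding \<A>_def mem_Collect_eq by (intro conjI ballI order_refl)
    then show "\<A> \<noteq> {}"
      by blast
  next
    fix \<C> assume \<C>: "\<C> \<noteq> {}" "subset.chain \<A> \<C>"
    then have mem: "U \<in> \<A>" if "U \<in> \<C>" for U
      using that by (auto simp: subset.chain_def)
    have "\<not> F \<subseteq> \<Union>\<C>" if F: "F \<in> \<F>" for F
    proof
      assume "F \<subseteq> \<Union>\<C>"
      then obtain U where "U \<in> \<C>" "F \<subseteq> U"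
        by (rule finite_subset_Union_chain[OF fin(1)[OF F] _ \<C>])
      then show False
        using mem F unfolding \<A>_def by blast
    qed
    moreover have "up_set X U \<subseteq> U" if "U \<in> \<C>" for U
      using mem[OF that] by (simp add: \<A>_def)
    then have "up_set X (\<Union>\<C>) \<subseteq> \<Union>\<C>"
      unfolding up_set_def by blast
    ultimately show "\<Union>\<C> \<in> \<A>"
      using mem \<C>(1) unfolding \<A>_def by blast
  qed
  then obtain U where U: "U \<in> \<A>" and max: "\<And>V. V \<in> \<A> \<Longrightarrow> U \<subseteq> V \<Longrightarrow> V = U"
    by blast
  have "up_set X U \<subseteq> U"
    using U by (simp add: \<A>_def)
  then have upU: "y \<in> U" if "x \<in> U" "spec_le X x y" for x y
    using that by (meson mem_up_set subsetD)
  have grow: "\<exists>F\<in>\<F>. F \<subseteq> U \<union> up_set X {x}" if x: "x \<in> topspace X - U" for x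
  proof (rule ccontr)
    assume "\<not> ?thesis"
    moreover have "up_set X (U \<union> up_set X {x}) \<subseteq> U \<union> up_set X {x}"
      unfolding up_set_def using upU spec_le_trans by fast
    moreover have "up_set X {x} \<subseteq> topspace X"
      by (auto simp: up_set_def)
    ultimately have "U \<union> up_set X {x} \<in> \<A>"
      using U unfolding \<A>_def by blast
    then have "up_set X {x} \<subseteq> U"
      using max by blast
    then show False
      using x spec_le_refl[of x X] by (auto simp: up_set_def)
  qed
  have meets: "(topspace X - U) \<inter> F \<noteq> {}" if "F \<in> \<F>" for F
    using U that fin(2)[OF that] unfolding \<A>_def by blast
  have "directed_subset X (topspace X - U)"
    unfolding directed_subset_def
  proof (intro conjI ballI)
    show "topspace X - U \<noteq> {}"
      using \<F> meets by (force simp: directed_family_def)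
  next
    fix x y assume "x \<in> topspace X - U" "y \<in> topspace X - U"
    then obtain F1 F2 where F12: "F1 \<in> \<F>" "F1 \<subseteq> U \<union> up_set X {x}" "F2 \<in> \<F>" "F2 \<subseteq> U \<union> up_set X {y}"
      using grow by meson
    then obtain F where F: "F \<in> \<F>" "F \<subseteq> up_set X F1 \<inter> up_set X F2"
      using \<F> unfolding directed_family_def by meson
    obtain z where z: "z \<in> topspace X - U" "z \<in> F"
      using meets[OF F(1)] by blast
    have "z \<in> up_set X F1" "z \<in> up_set X F2"
      using F(2) z(2) by auto
    then obtain f1 f2 where f: "f1 \<in> F1" "spec_le X f1 z" "f2 \<in> F2" "spec_le X f2 z"
      unfolding mem_up_set by blast
    then have "f1 \<notin> U" "f2 \<notin> U"
      using z upU by blast+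
    then have "f1 \<in> up_set X {x}" "f2 \<in> up_set X {y}"
      using f F12 by blast+
    then have "spec_le X x z" "spec_le X y z"
      using f spec_le_trans by (auto simp: mem_up_set)
    then show "\<exists>z\<in>topspace X - U. spec_le X x z \<and> spec_le X y z"
      using z by blast
  qed auto
  moreover have "(topspace X - U) \<inter> K = {}"
    using U by (auto simp: \<A>_def)
  ultimately show ?thesis
    using meets by blast
qed

text \<open>
  Otherwise Rudin's lemma supplies a directed set that meets every member of the family and avoids
  all points above \<open>b\<close>; it still converges to \<open>x\<close>, contradicting \<open>b \<lless> x\<close>.
\<close>

lemma way_below_family:
  assumes "way_below X b x" "family_converges X \<F> x"
  obtains F where "F \<in> \<F>" "F \<subseteq> up_set X {b}"
proof (rule ccontr)
  assume "\<not> thesis"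
  with that have no: "\<And>F. F \<in> \<F> \<Longrightarrow> \<not> F \<subseteq> up_set X {b}"
    by blast
  have \<F>: "directed_family X \<F>" and x: "x \<in> topspace X"
    and conv: "\<And>U. openin X U \<Longrightarrow> x \<in> U \<Longrightarrow> \<exists>F\<in>\<F>. F \<subseteq> U"
    using assms(2) by (auto simp: family_converges_def)
  have bX: "up_set X {b} \<subseteq> topspace X"
    by (auto simp: up_set_def)
  obtain D where D: "directed_subset X D" "D \<inter> up_set X {b} = {}"
    and meets: "\<forall>F\<in>\<F>. D \<inter> F \<noteq> {}"
    using Rudin_lemma[OF \<F> bX up_set_least[OF subset_refl] no] by blast
  have "D \<inter> U \<noteq> {}" if "openin X U" "x \<in> U" for U
    using conv[OF that] meets by fast
  then have "net_converges X D x"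
    using x by (simp add: net_converges_iff[OF D(1)])
  then obtain d where "d \<in> D" "spec_le X b d"
    using assms(1) D(1) unfolding way_below_def by blast
  then show False
    using D(2) by (auto simp: mem_up_set)
qed

section \<open>The way-above sets of a QFS-space are open\<close>

text \<open>
  If each value \<open>y \<in> F\<close> were missing above some \<open>w y \<in> D\<close>, then \<open>h\<close> would have no value left at an
  upper bound of the finitely many \<open>w y\<close>.
\<close>

lemma directed_subset_cofinal_fibre:
  assumes D: "directed_subset X D" and h: "finite F" "h ` D \<subseteq> F"
  shows "\<exists>y\<in>F. \<forall>d\<in>D. \<exists>e\<in>D. spec_le X d e \<and> h e = y"
proof (rule ccontr)
  assume "\<not> ?thesis"
  then have "\<forall>y\<in>F. \<exists>d\<in>D. \<forall>e\<in>D. spec_le X d e \<longrightarrow> h e \<noteq> y"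
    by simp
  then obtain w where w: "\<forall>y\<in>F. w y \<in> D \<and> (\<forall>e\<in>D. spec_le X (w y) e \<longrightarrow> h e \<noteq> y)"
    by metis
  have "\<exists>d\<in>D. \<forall>y\<in>G. spec_le X (w y) d" if "finite G" "G \<subseteq> F" for G
    using that
  proof (induction G rule: finite_induct)
    case empty
    then show ?case
      using D by (auto simp: directed_subset_def)
  next
    case (insert y G)
    then obtain d where d: "d \<in> D" "\<forall>y\<in>G. spec_le X (w y) d"
      by blast
    obtain e where e: "e \<in> D" "spec_le X d e" "spec_le X (w y) e"
      using d(1) D w insert.prems unfolding directed_subset_def by blast
    have "\<forall>u\<in>insert y G. spec_le X (w u) e"
      using d(2) e(2,3) spec_le_trans[of X _ d e] by simp
    then show ?case
      using e(1) by (rule bexI)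
  qed
  then obtain d where "d \<in> D" "\<forall>y\<in>F. spec_le X (w y) d"
    using h by blast
  then show False
    using w h(2) by blast
qed

text \<open>
  Assign to each \<open>d \<in> D\<close> a point \<open>h d\<close> of the finite set \<open>F\<close> that separates \<open>d\<close> from \<open>\<delta> d\<close>. Some
  \<open>y \<in> F\<close> is assigned cofinally, so \<open>y\<close> lies below a point of \<open>D\<close> and, by monotonicity of \<open>\<delta>\<close>, in
  \<open>\<up>\<delta> d\<close> for every \<open>d \<in> D\<close>. By the continuity of \<open>\<delta>\<close> the point \<open>y\<close> is then in every open set around \<open>\<delta> z\<close>,
  that is, above \<open>\<delta> z\<close>.
\<close>

lemma quasi_finitely_separating_meets:
  assumes \<delta>: "quasi_finitely_separating X \<delta>"
    and D: "directed_subset X D" "net_converges X D z"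
  shows "D \<inter> up_set X (\<delta> z) \<noteq> {}"
proof -
  have D0: "D \<subseteq> topspace X" "D \<noteq> {}" and z: "z \<in> topspace X"
    using D by (auto simp: directed_subset_def net_converges_def)
  note mono = quasi_finitely_separatingD(2)[OF \<delta>]
    and cont = quasi_finitely_separatingD(4)[OF \<delta> D]
  have \<delta>z: "\<delta> z \<subseteq> topspace X"
    using quasi_finitely_separatingD(1)[OF \<delta> z] by (simp add: fin_subsets_def)
  obtain F where F: "finite F" "F \<subseteq> topspace X"
    "\<forall>x\<in>topspace X. \<exists>y\<in>F. x \<in> up_set X {y} \<and> up_set X {y} \<subseteq> up_set X (\<delta> x)"
    using quasi_finitely_separatingD(3)[OF \<delta>] by blast
  then obtain h where h: "\<And>x. x \<in> topspace X \<Longrightarrow>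
      h x \<in> F \<and> x \<in> up_set X {h x} \<and> up_set X {h x} \<subseteq> up_set X (\<delta> x)"
    by metis
  have "h ` D \<subseteq> F"
    using h D0(1) by blast
  then obtain y where y: "y \<in> F" "\<And>d. d \<in> D \<Longrightarrow> \<exists>e\<in>D. spec_le X d e \<and> h e = y"
    using directed_subset_cofinal_fibre[OF D(1) F(1)] by meson
  have yX: "y \<in> topspace X"
    using y F by blast
  have yd: "y \<in> up_set X (\<delta> d)" if d: "d \<in> D" for d
  proof -
    obtain e where e: "e \<in> D" "spec_le X d e" "h e = y"
      using y(2) d by blast
    then have "y \<in> up_set X (\<delta> e)"
      using h[of e] D0 spec_le_refl[OF yX] by (auto simp: mem_up_set subset_iff)
    then show ?thesis
      using up_set_least[OF mono[OF e(2)]] by blast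
  qed
  have "y \<in> up_set X (\<delta> z)"
  proof (rule up_set_eq_saturation[OF \<delta>z yX])
    fix U assume U: "openin X U" "\<delta> z \<subseteq> U"
    then obtain d where "d \<in> D" "\<delta> d \<subseteq> U"
      using cont by blast
    then show "y \<in> U"
      using yd up_set_subset_openin[OF U(1)] by blast
  qed
  then obtain x where x: "x \<in> \<delta> z" "spec_le X x y"
    by (auto simp: mem_up_set)
  obtain e where e: "e \<in> D" "h e = y"
    using y(2) D0(2) by blast
  then have "spec_le X y e"
    using h[of e] D0(1) by (auto simp: mem_up_set)
  then have "e \<in> up_set X (\<delta> z)"
    using x spec_le_trans[OF x(2)] by (auto simp: mem_up_set)
  then show ?thesis
    using e(1) by blast
qed

lemma directed_maps_finite_bound:
  assumes \<D>: "directed_maps X \<D>" and "finite \<G>" "\<G> \<subseteq> \<D>"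
  shows "\<exists>\<delta>\<in>\<D>. \<forall>\<gamma>\<in>\<G>. \<forall>x\<in>topspace X. \<delta> x \<subseteq> up_set X (\<gamma> x)"
  using assms(2,3)
proof (induction \<G> rule: finite_induct)
  case empty
  then show ?case
    using directed_mapsD(2)[OF \<D>] by blast
next
  case (insert \<gamma> \<G>)
  then obtain \<epsilon> where \<epsilon>: "\<epsilon> \<in> \<D>" "\<forall>\<gamma>\<in>\<G>. \<forall>x\<in>topspace X. \<epsilon> x \<subseteq> up_set X (\<gamma> x)"
    by blast
  then obtain \<delta> where \<delta>: "\<delta> \<in> \<D>" "\<forall>x\<in>topspace X. \<delta> x \<subseteq> up_set X (\<epsilon> x) \<inter> up_set X (\<gamma> x)"
    using directed_mapsD(3)[OF \<D>, of \<epsilon> \<gamma>] insert.prems by blast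
  have "\<delta> x \<subseteq> up_set X (\<gamma>' x)" if \<gamma>': "\<gamma>' \<in> insert \<gamma> \<G>" and x: "x \<in> topspace X" for \<gamma>' x
  proof (cases "\<gamma>' = \<gamma>")
    case True
    then show ?thesis
      using \<delta>(2) x by simp
  next
    case False
    then have "\<epsilon> x \<subseteq> up_set X (\<gamma>' x)"
      using \<epsilon>(2) \<gamma>' x by simp
    moreover have "\<delta> x \<subseteq> up_set X (\<epsilon> x)"
      using \<delta>(2) x by simp
    ultimately show ?thesis
      using up_set_least by blast
  qed
  then show ?case
    using \<delta>(1) by blast
qed

text \<open>
  Given an open \<open>U\<close> around \<open>x\<close>, first take \<open>\<delta>\<close> with \<open>\<delta> x \<subseteq> U\<close>. Each of the finitely many points
  \<open>z \<in> \<delta> x\<close> has its own map that sends it to a subset of \<open>U\<close>, and directedness bounds these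
  maps by a single \<open>\<delta>'\<close>.
\<close>

lemma family_converges_iterated:
  assumes \<D>: "quasi_approximate_identity X \<D>"
    and qfs: "\<And>\<delta>. \<delta> \<in> \<D> \<Longrightarrow> quasi_finitely_separating X \<delta>"
    and x: "x \<in> topspace X"
  shows "family_converges X {\<Union>z\<in>\<delta> x. \<delta>' z |\<delta> \<delta>'. \<delta> \<in> \<D> \<and> \<delta>' \<in> \<D>} x"
proof -
  note dir = quasi_approximate_identityD(1)[OF \<D>] and conv = quasi_approximate_identityD(2)[OF \<D>]
  have val: "\<delta> y \<subseteq> topspace X" "finite (\<delta> y)" "\<delta> y \<noteq> {}" if "\<delta> \<in> \<D>" "y \<in> topspace X" for \<delta> y
    using directed_mapsD(1)[OF dir that] by (simp_all add: fin_subsets_def)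
  note mono = quasi_finitely_separatingD(2)[OF qfs] and bound = directed_mapsD(3)[OF dir]
  have refine: "(\<Union>z\<in>\<delta> x. \<delta>' z) \<subseteq> up_set X (\<Union>z\<in>\<gamma> x. \<gamma>' z)"
    if m: "\<delta> \<in> \<D>" "\<gamma>' \<in> \<D>"
      and le: "\<delta> x \<subseteq> up_set X (\<gamma> x)" "\<forall>y\<in>topspace X. \<delta>' y \<subseteq> up_set X (\<gamma>' y)" for \<delta> \<delta>' \<gamma> \<gamma>'
  proof (rule UN_least)
    fix z assume z: "z \<in> \<delta> x"
    then obtain y where y: "y \<in> \<gamma> x" "spec_le X y z"
      using le(1) by (auto simp: mem_up_set subset_iff)
    have "\<delta>' z \<subseteq> up_set X (\<gamma>' z)"
      using le(2) z val(1)[OF m(1) x] by blast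
    also have "\<dots> \<subseteq> up_set X (\<gamma>' y)"
      by (rule up_set_least[OF mono[OF m(2) y(2)]])
    also have "\<dots> \<subseteq> up_set X (\<Union>z\<in>\<gamma> x. \<gamma>' z)"
      using y(1) unfolding up_set_def by blast
    finally show "\<delta>' z \<subseteq> up_set X (\<Union>z\<in>\<gamma> x. \<gamma>' z)" .
  qed
  let ?\<F> = "{\<Union>z\<in>\<delta> x. \<delta>' z |\<delta> \<delta>'. \<delta> \<in> \<D> \<and> \<delta>' \<in> \<D>}"
  have "directed_family X ?\<F>"
    unfolding directed_family_def
  proof (intro conjI ballI)
    show "?\<F> \<subseteq> fin_subsets X"
    proof
      fix F assume "F \<in> ?\<F>"
      then obtain \<delta> \<delta>' where F: "F = (\<Union>z\<in>\<delta> x. \<delta>' z)" "\<delta> \<in> \<D>" "\<delta>' \<in> \<D>"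
        by blast
      have "\<delta>' z \<subseteq> topspace X \<and> finite (\<delta>' z) \<and> \<delta>' z \<noteq> {}" if "z \<in> \<delta> x" for z
        using val[OF F(3)] val(1)[OF F(2) x] that by blast
      then show "F \<in> fin_subsets X"
        using val(2,3)[OF F(2) x] unfolding F(1) fin_subsets_def by blast
    qed
    show "?\<F> \<noteq> {}"
      using directed_mapsD(2)[OF dir] by blast
  next
    fix F1 F2 assume "F1 \<in> ?\<F>" "F2 \<in> ?\<F>"
    then obtain \<gamma>1 \<gamma>1' \<gamma>2 \<gamma>2' where
      F1: "F1 = (\<Union>z\<in>\<gamma>1 x. \<gamma>1' z)" "\<gamma>1 \<in> \<D>" "\<gamma>1' \<in> \<D>" and
      F2: "F2 = (\<Union>z\<in>\<gamma>2 x. \<gamma>2' z)" "\<gamma>2 \<in> \<D>" "\<gamma>2' \<in> \<D>"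
      by blast
    obtain \<delta> where \<delta>: "\<delta> \<in> \<D>" "\<forall>y\<in>topspace X. \<delta> y \<subseteq> up_set X (\<gamma>1 y) \<inter> up_set X (\<gamma>2 y)"
      using bound[OF F1(2) F2(2)] by blast
    obtain \<delta>' where \<delta>': "\<delta>' \<in> \<D>" "\<forall>y\<in>topspace X. \<delta>' y \<subseteq> up_set X (\<gamma>1' y) \<inter> up_set X (\<gamma>2' y)"
      using bound[OF F1(3) F2(3)] by blast
    have "(\<Union>z\<in>\<delta> x. \<delta>' z) \<subseteq> up_set X F1" "(\<Union>z\<in>\<delta> x. \<delta>' z) \<subseteq> up_set X F2"
      unfolding F1(1) F2(1) using \<delta>(2) \<delta>'(2) x
      by (simp_all add: refine[OF \<delta>(1) F1(3)] refine[OF \<delta>(1) F2(3)])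
    then show "\<exists>F\<in>?\<F>. F \<subseteq> up_set X F1 \<inter> up_set X F2"
      using \<delta>(1) \<delta>'(1) by blast
  qed
  moreover have "\<exists>F\<in>?\<F>. F \<subseteq> U" if U: "openin X U" "x \<in> U" for U
  proof -
    obtain \<delta> where \<delta>: "\<delta> \<in> \<D>" "\<delta> x \<subseteq> U"
      using conv[OF U] by blast
    obtain g where g: "\<And>z. z \<in> \<delta> x \<Longrightarrow> g z \<in> \<D> \<and> g z z \<subseteq> U"
      using conv[OF U(1)] \<delta>(2) by (metis subsetD)
    have "finite (g ` \<delta> x)" "g ` \<delta> x \<subseteq> \<D>"
      using val(2)[OF \<delta>(1) x] g by auto
    then obtain \<delta>' where \<delta>': "\<delta>' \<in> \<D>"
      "\<forall>\<gamma>\<in>g ` \<delta> x. \<forall>y\<in>topspace X. \<delta>' y \<subseteq> up_set X (\<gamma> y)"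
      using directed_maps_finite_bound[OF dir] by blast
    have "\<delta>' z \<subseteq> U" if z: "z \<in> \<delta> x" for z
    proof -
      have "\<delta>' z \<subseteq> up_set X (g z z)"
        using \<delta>'(2) z val(1)[OF \<delta>(1) x] by blast
      also have "\<dots> \<subseteq> U"
        using g[OF z] U(1) by (simp add: up_set_subset_openin)
      finally show ?thesis .
    qed
    then show ?thesis
      using \<delta>(1) \<delta>'(1) by blast
  qed
  ultimately show ?thesis
    using x by (simp add: family_converges_def)
qed

lemma way_below_if_subset_up_set:
  assumes "quasi_finitely_separating X \<delta>" "b \<in> topspace X" "z \<in> topspace X"
    and "\<delta> z \<subseteq> up_set X {b}"
  shows "way_below X b z"
  using assms quasi_finitely_separating_meets[OF assms(1)] up_set_least[OF assms(4)]
  unfolding way_below_def by (fastforce simp: mem_up_set)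

lemma way_below_spec_le:
  assumes "way_below X b x" "spec_le X x y"
  shows "way_below X b y"
proof -
  have "y \<in> topspace X"
    using assms(2) by (simp add: spec_le_iff)
  then show ?thesis
    using assms net_converges_lower unfolding way_below_def by metis
qed

lemma openin_way_above:
  assumes X: "QFS_space X"
  shows "openin X (way_above X b)"
proof -
  obtain \<D> where \<D>: "quasi_approximate_identity X \<D>"
    and qfs: "\<And>\<delta>. \<delta> \<in> \<D> \<Longrightarrow> quasi_finitely_separating X \<delta>"
    using X unfolding QFS_space_def by blast
  have "D \<inter> way_above X b \<noteq> {}"
    if D: "directed_subset X D" "x \<in> way_above X b" "net_converges X D x" for D x
  proof -
    have bx: "way_below X b x" and x: "x \<in> topspace X" and b: "b \<in> topspace X"
      using D(2) by (auto simp: way_above_def way_below_def)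
    obtain F where F: "F \<in> {\<Union>z\<in>\<delta> x. \<delta>' z |\<delta> \<delta>'. \<delta> \<in> \<D> \<and> \<delta>' \<in> \<D>}" "F \<subseteq> up_set X {b}"
      by (rule way_below_family[OF bx family_converges_iterated[OF \<D> qfs x]])
    from F(1) obtain \<delta> \<delta>' where \<delta>: "F = (\<Union>z\<in>\<delta> x. \<delta>' z)" "\<delta> \<in> \<D>" "\<delta>' \<in> \<D>"
      by blast
    have \<delta>x: "\<delta> x \<subseteq> topspace X"
      using quasi_finitely_separatingD(1)[OF qfs[OF \<delta>(2)] x] by (simp add: fin_subsets_def)
    have above: "way_below X b z" if "z \<in> \<delta> x" for z
    proof (rule way_below_if_subset_up_set[OF qfs[OF \<delta>(3)] b])
      show "z \<in> topspace X"
        using that \<delta>x by blast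
      show "\<delta>' z \<subseteq> up_set X {b}"
        using that F(2) \<delta>(1) by blast
    qed
    obtain d where d: "d \<in> D" "d \<in> up_set X (\<delta> x)"
      using quasi_finitely_separating_meets[OF qfs[OF \<delta>(2)] D(1,3)] by blast
    then have "way_below X b d"
      using above way_below_spec_le by (metis mem_up_set)
    then show ?thesis
      using d(1) by (auto simp: way_above_def way_below_def)
  qed
  then have "directed_open X (way_above X b)"
    unfolding directed_open_def by (auto simp: way_above_def)
  then show ?thesis
    using X by (simp add: QFS_space_def directed_space_openin_iff)
qed

section \<open>Retracts of QFS-spaces\<close>

lemma retraction_maps_t0_space:
  assumes "retraction_maps X Y r s" "t0_space X"
  shows "t0_space Y"
  unfolding t0_space_def
proof (intro ballI impI)
  fix x y assume xy: "x \<in> topspace Y" "y \<in> topspace Y" "x \<noteq> y"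
  have s: "continuous_map Y X s" "\<And>y. y \<in> topspace Y \<Longrightarrow> r (s y) = y"
    using assms(1) by (auto simp: retraction_maps_def)
  then have "s x \<in> topspace X" "s y \<in> topspace X" "s x \<noteq> s y"
    using xy by (auto simp: continuous_map_def) metis
  then obtain U where U: "openin X U" "s x \<notin> U \<longleftrightarrow> s y \<in> U"
    using assms(2) unfolding t0_space_def by blast
  then have "openin Y {z \<in> topspace Y. s z \<in> U}"
    using s(1) by (simp add: openin_continuous_map_preimage)
  then show "\<exists>U. openin Y U \<and> (x \<notin> U \<longleftrightarrow> y \<in> U)"
    using U xy by blast
qed

text \<open>
  If \<open>U\<close> is directed open in \<open>Y\<close>, its preimage under \<open>r\<close> is directed open, hence open, in \<open>X\<close>, and \<open>U\<close> is
  the preimage of that open set under the section.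
\<close>

lemma directed_space_retract:
  assumes rs: "retraction_maps X Y r s" and X: "directed_space X"
  shows "directed_space Y"
proof -
  have r: "continuous_map X Y r" and s: "continuous_map Y X s"
    and id: "\<And>y. y \<in> topspace Y \<Longrightarrow> r (s y) = y"
    using rs by (auto simp: retraction_maps_def)
  have "openin Y U" if U: "directed_open Y U" for U
  proof -
    have "directed_open X {x \<in> topspace X. r x \<in> U}"
      unfolding directed_open_def
    proof (intro conjI allI impI; (elim conjE)?)
      fix D x assume D: "directed_subset X D" "x \<in> {x \<in> topspace X. r x \<in> U}" "net_converges X D x"
      then have "r ` D \<inter> U \<noteq> {}"
        using U directed_subset_image[OF r D(1)] net_converges_image[OF r D(1,3)]
        unfolding directed_open_def by blast
      then show "D \<inter> {x \<in> topspace X. r x \<in> U} \<noteq> {}"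
        using D(1) by (auto simp: directed_subset_def)
    qed auto
    then have "openin X {x \<in> topspace X. r x \<in> U}"
      using X by (simp add: directed_space_openin_iff)
    then have "openin Y {y \<in> topspace Y. s y \<in> {x \<in> topspace X. r x \<in> U}}"
      using s by (rule openin_continuous_map_preimage[rotated])
    also have "{y \<in> topspace Y. s y \<in> {x \<in> topspace X. r x \<in> U}} = U"
      using U id s by (auto simp: directed_open_def continuous_map_def)
    finally show ?thesis .
  qed
  then show ?thesis
    using X retraction_maps_t0_space[OF rs] openin_imp_directed_open
    unfolding directed_space_def by blast
qed

lemma up_set_image:
  assumes "continuous_map X Y r" "A \<subseteq> up_set X B"
  shows "r ` A \<subseteq> up_set Y (r ` B)"
  using assms(2) spec_le_continuous_map[OF assms(1)] by (fastforce simp: mem_up_set)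

lemma fin_subsets_image:
  "continuous_map X Y r \<Longrightarrow> F \<in> fin_subsets X \<Longrightarrow> r ` F \<in> fin_subsets Y"
  by (auto simp: fin_subsets_def continuous_map_def)

text \<open>The finite separating set of the new map is the image under \<open>r\<close> of the old one.\<close>

lemma quasi_finitely_separating_retract:
  assumes rs: "retraction_maps X Y r s" and \<delta>: "quasi_finitely_separating X \<delta>"
  shows "quasi_finitely_separating Y (\<lambda>y. r ` \<delta> (s y))"
proof -
  have r: "continuous_map X Y r" and s: "continuous_map Y X s"
    and id: "\<And>y. y \<in> topspace Y \<Longrightarrow> r (s y) = y"
    using rs by (auto simp: retraction_maps_def)
  have sX: "s y \<in> topspace X" if "y \<in> topspace Y" for y
    using s that by (auto simp: continuous_map_def)
  note val = quasi_finitely_separatingD(1)[OF \<delta>] and mono = quasi_finitely_separatingD(2)[OF \<delta>]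
    and cont = quasi_finitely_separatingD(4)[OF \<delta>]
  obtain F where F: "finite F" "F \<subseteq> topspace X"
    "\<And>x. x \<in> topspace X \<Longrightarrow> \<exists>y\<in>F. x \<in> up_set X {y} \<and> up_set X {y} \<subseteq> up_set X (\<delta> x)"
    using quasi_finitely_separatingD(3)[OF \<delta>] by blast
  show ?thesis
    unfolding quasi_finitely_separating_def
  proof (intro conjI allI impI; (elim conjE)?)
    show "(\<lambda>y. r ` \<delta> (s y)) \<in> topspace Y \<rightarrow> fin_subsets Y"
      using val sX fin_subsets_image[OF r] by auto
  next
    fix x y assume "spec_le Y x y"
    then show "r ` \<delta> (s y) \<subseteq> up_set Y (r ` \<delta> (s x))"
      by (intro up_set_image[OF r] mono spec_le_continuous_map[OF s])
  next
    have "\<exists>z\<in>r ` F. y \<in> up_set Y {z} \<and> up_set Y {z} \<subseteq> up_set Y (r ` \<delta> (s y))"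
      if y: "y \<in> topspace Y" for y
    proof -
      obtain u where u: "u \<in> F" "s y \<in> up_set X {u}" "up_set X {u} \<subseteq> up_set X (\<delta> (s y))"
        using F(3)[OF sX[OF y]] by blast
      have "spec_le Y (r u) y"
        using u(2) id[OF y] spec_le_continuous_map[OF r] by (fastforce simp: mem_up_set)
      moreover have "{u} \<subseteq> up_set X (\<delta> (s y))"
        using u F(2) spec_le_refl[of u X] by (auto simp: mem_up_set subset_iff)
      then have "{r u} \<subseteq> up_set Y (r ` \<delta> (s y))"
        using up_set_image[OF r] by fastforce
      then have "up_set Y {r u} \<subseteq> up_set Y (r ` \<delta> (s y))"
        by (rule up_set_least)
      ultimately show ?thesis
        using u(1) by (auto simp: mem_up_set)
    qed
    moreover have "r ` F \<subseteq> topspace Y"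
      using F(2) r by (auto simp: continuous_map_def)
    ultimately show "\<exists>F. finite F \<and> F \<subseteq> topspace Y \<and>
        (\<forall>y\<in>topspace Y. \<exists>z\<in>F. y \<in> up_set Y {z} \<and> up_set Y {z} \<subseteq> up_set Y (r ` \<delta> (s y)))"
      using F(1) by (intro exI[of _ "r ` F"]) auto
  next
    fix D x U
    assume D: "directed_subset Y D" "net_converges Y D x" and U: "openin Y U" "r ` \<delta> (s x) \<subseteq> U"
    have D0: "D \<subseteq> topspace Y" "x \<in> topspace Y"
      using D by (auto simp: directed_subset_def net_converges_def)
    have "openin X {z \<in> topspace X. r z \<in> U}"
      using r U by (simp add: openin_continuous_map_preimage)
    moreover have "\<delta> (s x) \<subseteq> {z \<in> topspace X. r z \<in> U}"
      using U(2) val[OF sX[OF D0(2)]] by (auto simp: fin_subsets_def)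
    ultimately obtain d where "d \<in> s ` D" "\<delta> d \<subseteq> {z \<in> topspace X. r z \<in> U}"
      using cont[OF directed_subset_image[OF s D(1)] net_converges_image[OF s D]] by blast
    then show "\<exists>d\<in>D. r ` \<delta> (s d) \<subseteq> U"
      by blast
  qed
qed

lemma directed_family_values:
  assumes \<D>: "directed_maps X \<D>" and x: "x \<in> topspace X"
  shows "directed_family X {\<delta> x |\<delta>. \<delta> \<in> \<D>}"
  unfolding directed_family_def
proof (intro conjI ballI)
  show "{\<delta> x |\<delta>. \<delta> \<in> \<D>} \<subseteq> fin_subsets X"
    using directed_mapsD(1)[OF \<D> _ x] by blast
  show "{\<delta> x |\<delta>. \<delta> \<in> \<D>} \<noteq> {}"
    using directed_mapsD(2)[OF \<D>] by blast
next
  fix F1 F2 assume "F1 \<in> {\<delta> x |\<delta>. \<delta> \<in> \<D>}" "F2 \<in> {\<delta> x |\<delta>. \<delta> \<in> \<D>}"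
  then obtain \<delta>1 \<delta>2 where F12: "F1 = \<delta>1 x" "\<delta>1 \<in> \<D>" "F2 = \<delta>2 x" "\<delta>2 \<in> \<D>"
    by blast
  then obtain \<delta> where "\<delta> \<in> \<D>" "\<delta> x \<subseteq> up_set X F1 \<inter> up_set X F2"
    using directed_mapsD(3)[OF \<D> F12(2,4)] x by blast
  then show "\<exists>F\<in>{\<delta> x |\<delta>. \<delta> \<in> \<D>}. F \<subseteq> up_set X F1 \<inter> up_set X F2"
    by blast
qed

lemma quasi_approximate_identity_retract:
  assumes rs: "retraction_maps X Y r s" and \<D>: "quasi_approximate_identity X \<D>"
  shows "quasi_approximate_identity Y ((\<lambda>\<delta> y. r ` \<delta> (s y)) ` \<D>)"
proof -
  let ?T = "\<lambda>\<delta> y. r ` \<delta> (s y)"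
  have r: "continuous_map X Y r" and s: "continuous_map Y X s"
    and id: "\<And>y. y \<in> topspace Y \<Longrightarrow> r (s y) = y"
    using rs by (auto simp: retraction_maps_def)
  have sX: "s y \<in> topspace X" if "y \<in> topspace Y" for y
    using s that by (auto simp: continuous_map_def)
  note dir = quasi_approximate_identityD(1)[OF \<D>] and conv = quasi_approximate_identityD(2)[OF \<D>]
  have dirT: "directed_maps Y (?T ` \<D>)"
    unfolding directed_maps_def
  proof (intro conjI ballI)
    show "?T ` \<D> \<subseteq> topspace Y \<rightarrow> fin_subsets Y"
      using directed_mapsD(1)[OF dir] sX fin_subsets_image[OF r] by blast
    show "?T ` \<D> \<noteq> {}"
      using directed_mapsD(2)[OF dir] by blast
  next
    fix \<epsilon>1 \<epsilon>2 assume "\<epsilon>1 \<in> ?T ` \<D>" "\<epsilon>2 \<in> ?T ` \<D>"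
    then obtain \<delta>1 \<delta>2 where e: "\<epsilon>1 = ?T \<delta>1" "\<delta>1 \<in> \<D>" "\<epsilon>2 = ?T \<delta>2" "\<delta>2 \<in> \<D>"
      by blast
    then obtain \<delta> where \<delta>: "\<delta> \<in> \<D>"
      "\<forall>x\<in>topspace X. \<delta> x \<subseteq> up_set X (\<delta>1 x) \<inter> up_set X (\<delta>2 x)"
      using directed_mapsD(3)[OF dir, of \<delta>1 \<delta>2] by blast
    have "?T \<delta> y \<subseteq> up_set Y (\<epsilon>1 y) \<inter> up_set Y (\<epsilon>2 y)" if "y \<in> topspace Y" for y
      using \<delta>(2) sX[OF that] up_set_image[OF r] unfolding e by simp
    then show "\<exists>\<epsilon>\<in>?T ` \<D>. \<forall>y\<in>topspace Y. \<epsilon> y \<subseteq> up_set Y (\<epsilon>1 y) \<inter> up_set Y (\<epsilon>2 y)"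
      by (intro bexI[OF _ imageI[OF \<delta>(1)]] ballI)
  qed
  have "family_converges Y {\<epsilon> y |\<epsilon>. \<epsilon> \<in> ?T ` \<D>} y" if y: "y \<in> topspace Y" for y
    unfolding family_converges_def
  proof (intro conjI allI impI y; (elim conjE)?)
    show "directed_family Y {\<epsilon> y |\<epsilon>. \<epsilon> \<in> ?T ` \<D>}"
      by (rule directed_family_values[OF dirT y])
  next
    fix U assume U: "openin Y U" "y \<in> U"
    have "openin X {z \<in> topspace X. r z \<in> U}"
      using r U by (simp add: openin_continuous_map_preimage)
    then obtain \<delta> where "\<delta> \<in> \<D>" "\<delta> (s y) \<subseteq> {z \<in> topspace X. r z \<in> U}"
      using conv[of _ "s y"] sX[OF y] id[OF y] U(2) by force
    then have "?T \<delta> \<in> ?T ` \<D>" "?T \<delta> y \<subseteq> U"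
      by auto
    then show "\<exists>F\<in>{\<epsilon> y |\<epsilon>. \<epsilon> \<in> ?T ` \<D>}. F \<subseteq> U"
      unfolding Bex_def mem_Collect_eq by (intro exI conjI) (rule refl)
  qed
  then show ?thesis
    using dirT unfolding quasi_approximate_identity_def by blast
qed

lemma QFS_space_retract:
  assumes rs: "retraction_maps X Y r s" and X: "QFS_space X"
  shows "QFS_space Y"
proof -
  obtain \<D> where \<D>: "quasi_approximate_identity X \<D>"
    and qfs: "\<forall>\<delta>\<in>\<D>. quasi_finitely_separating X \<delta>"
    using X unfolding QFS_space_def by blast
  have "directed_space Y"
    using X directed_space_retract[OF rs] by (simp add: QFS_space_def)
  moreover have "quasi_approximate_identity Y ((\<lambda>\<delta> y. r ` \<delta> (s y)) ` \<D>)"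
    by (rule quasi_approximate_identity_retract[OF rs \<D>])
  moreover have "\<forall>\<epsilon>\<in>(\<lambda>\<delta> y. r ` \<delta> (s y)) ` \<D>. quasi_finitely_separating Y \<epsilon>"
    using qfs quasi_finitely_separating_retract[OF rs] by simp
  ultimately show ?thesis
    unfolding QFS_space_def by blast
qed

section \<open>The retraction onto a way-above set with a lower bound\<close>

lemma retraction_maps_open_with_lower_bound:
  assumes W: "openin X W" and a: "lower_bound X a W"
  shows "retraction_maps X (subtopology X ({a} \<union> W)) (\<lambda>x. if x \<in> W then x else a) id"
proof -
  let ?r = "\<lambda>x. if x \<in> W then x else a"
  have aX: "a \<in> topspace X" and aW: "\<And>x. x \<in> W \<Longrightarrow> spec_le X a x"
    using a by (auto simp: lower_bound_def)
  have WX: "W \<subseteq> topspace X"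
    using W by (rule openin_subset)
  have "openin X {x \<in> topspace X. ?r x \<in> U}" if U: "openin X U" for U
  proof (cases "a \<in> U")
    case True
    then have "{x \<in> topspace X. ?r x \<in> U} = topspace X"
      using aW U by (auto intro: spec_le_openin)
    then show ?thesis by simp
  next
    case False
    then have "{x \<in> topspace X. ?r x \<in> U} = U \<inter> W"
      using WX by (auto split: if_splits)
    then show ?thesis
      using U W by (simp add: openin_Int)
  qed
  then have "continuous_map X X ?r"
    using aX by (auto simp: continuous_map_def)
  then show ?thesis
    by (auto simp: retraction_maps_def continuous_map_in_subtopology
        continuous_map_from_subtopology)
qed

theorem proposition4p7:
  fixes X :: "'a topology" and a b :: 'a
  assumes "QFS_space X"
    and "b \<in> topspace X"
    and "lower_bound X a (way_above X b)"
  shows "continuous_retract (subtopology X ({a} \<union> way_above X b)) X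
       \<and> QFS_space (subtopology X ({a} \<union> way_above X b))"
proof -
  note retract = retraction_maps_open_with_lower_bound[OF openin_way_above[OF assms(1)] assms(3)]
  show ?thesis
    using retract QFS_space_retract[OF retract assms(1)] by (auto simp: continuous_retract_def)
qed

end
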